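(* Let $0\leq s<1$ and $\delta>0$. Suppose that $u\in C_c^\infty(\mathbb{R}^n)$ and $\varphi\in C_c^\infty(\mathbb{R}^n,\mathbb{R}^n)$. Then $$\int_\Omega D^s_\delta u(x)\cdot\varphi(x)\,dx=-\int_\Omega u(y)\operatorname{div}^s_\delta\varphi(y)\,dy-c_{n,s}\int_{\Gamma_\delta}\int_\Omega\frac{u(y)\varphi(x)+u(x)\varphi(y)}{|y-x|}\cdot\frac{y-x}{|y-x|}\,\frac{w_\delta(x-y)}{|y-x|^{n-1+s}}\,dy\,dx .$$
   Context: Setting: $\Omega\subset\mathbb{R}^n$ is a bounded open set, $\gamma(t)=\pi^{n/2}2^t\Gamma(t/2)/\Gamma(\frac{n-t}{2})$ and $c_{n,s}=\frac{n+s-1}{\gamma(1-s)}$. The cut-off $w_\delta:\mathbb{R}^n\to[0,\infty)$ is a fixed radial function $w_\delta(x)=\bar w_\delta(|x|)$ with $\bar w_\delta\in C_c^\infty([0,\infty))$ nonnegative, nonincreasing, $\operatorname{supp}\bar w_\delta\subset[0,\delta)$, and $\bar w_\delta\equiv a_0:=\max\bar w_\delta$ on $[0,b_0\delta]$ for some $0<b_0<1$. Domains: $\Omega_\delta=\Omega+B(0,\delta)$, $\Gamma_\delta=\Omega_\delta\setminus\Omega$. Operators: for $u\in C_c^\infty(\mathbb{R}^n)$, $D^s_\delta u(x)=c_{n,s}\int_{B(x,\delta)}(u(x)-u(y))\frac{x-y}{|x-y|^{n+s+1}}w_\delta(x-y)\,dy$; for $\varphi\in C_c^\infty(\mathbb{R}^n,\mathbb{R}^n)$,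 $\operatorname{div}^s_\delta\varphi(x)=-c_{n,s}\,\mathrm{pv}_x\int_{B(x,\delta)}(\varphi(x)+\varphi(y))\cdot\frac{x-y}{|x-y|^{n+s+1}}w_\delta(x-y)\,dy$, where $\mathrm{pv}_x$ means the limit as $r\to0^+$ of the integral with $B(x,r)$ removed.
   Formalization: The integral over Γ_δ×Ω need not exist for every bounded open Ω: the formula is proved when it converges absolutely, and for all Ω as a principal value (B(x,r) removed from the inner domain, r→0+). For n=1, s=0, where c_{n,s} is 0/0, its limit 1/π is used. *)

theory Defs
  imports "HOL-Analysis.Analysis"
begin

(* On the sets used below (the whole space and the half-line [0, \<infinity>)) derivatives within the set
   are unique, so the existential picks out the usual (at 0: one-sided) derivative. *)
fun Ck_on :: "nat \<Rightarrow> ('a::real_normed_vector \<Rightarrow> 'b::real_normed_vector) \<Rightarrow> 'a set \<Rightarrow> bool" where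
  "Ck_on 0 f S \<longleftrightarrow> continuous_on S f"
| "Ck_on (Suc k) f S \<longleftrightarrow>
     (\<exists>f'. (\<forall>x\<in>S. (f has_derivative f' x) (at x within S)) \<and> (\<forall>v. Ck_on k (\<lambda>x. f' x v) S))"

definition smooth_on :: "('a::real_normed_vector \<Rightarrow> 'b::real_normed_vector) \<Rightarrow> 'a set \<Rightarrow> bool" where
  "smooth_on f S \<longleftrightarrow> (\<forall>k. Ck_on k f S)"

definition supp_on :: "('a::topological_space \<Rightarrow> 'b::zero) \<Rightarrow> 'a set \<Rightarrow> 'a set" where
  "supp_on f S = closure {x\<in>S. f x \<noteq> 0}"

definition Cc_inf :: "'a::real_normed_vector set \<Rightarrow> ('a \<Rightarrow> 'b::real_normed_vector) set" where
  "Cc_inf S = {f. smooth_on f S \<and> compact (supp_on f S) \<and> supp_on f S \<subseteq> S}"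

definition gamma_const :: "nat \<Rightarrow> real \<Rightarrow> real" where
  "gamma_const n t = pi powr (real n / 2) * 2 powr t * Gamma (t / 2) / Gamma ((real n - t) / 2)"

(* For n = 1, s = 0 the quotient is formally 0/0 because Gamma has a pole at 0; the value 1/pi is
   its continuous extension, see c_const_tendsto_0 below. *)
definition c_const :: "nat \<Rightarrow> real \<Rightarrow> real" where
  "c_const n s =
     (if n = 1 \<and> s = 0 then 1 / pi else (real n + s - 1) / gamma_const n (1 - s))"

lemma c_const_eq:
  assumes "n > 0" "0 \<le> s" "s < 1"
  shows "c_const n s =
    2 * Gamma ((real n + s + 1) / 2) / (pi powr (real n / 2) * 2 powr (1 - s) * Gamma ((1 - s) / 2))"
proof (cases "n = 1 \<and> s = 0")
  case True
  have "pi powr (1/2) * Gamma (1/2) = pi"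
    by (simp add: Gamma_one_half_real powr_half_sqrt)
  then show ?thesis using True by (simp add: c_const_def)
next
  case False
  let ?z = "(real n + s - 1) / 2"
  have "?z > 0" using assms False by (cases "n = 1") auto
  then have "Gamma (?z + 1) = ?z * Gamma ?z"
    by (intro Gamma_plus1) (auto elim!: nonpos_Ints_cases)
  moreover have "?z + 1 = (real n + s + 1) / 2" by (simp add: field_simps)
  ultimately have eq: "2 * Gamma ((real n + s + 1) / 2) = (real n + s - 1) * Gamma ?z" by simp
  have arg: "(real n - (1 - s)) / 2 = ?z" by simp
  have "c_const n s = (real n + s - 1) / gamma_const n (1 - s)"
    using False by (simp only: c_const_def if_False)
  also have "\<dots> = (real n + s - 1) * Gamma ?z /
      (pi powr (real n / 2) * 2 powr (1 - s) * Gamma ((1 - s) / 2))"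
    unfolding gamma_const_def arg by (simp only: divide_divide_eq_right)
  finally show ?thesis unfolding eq .
qed

lemma c_const_tendsto_0: "(c_const 1 \<longlongrightarrow> c_const 1 0) (at_right 0)"
proof -
  let ?f = "\<lambda>s::real. 2 * Gamma ((real 1 + s + 1) / 2) /
    (pi powr (real 1 / 2) * 2 powr (1 - s) * Gamma ((1 - s) / 2))"
  have lim: "(?f \<longlongrightarrow> ?f 0) (at_right 0)"
    by (intro tendsto_intros) (auto elim!: nonpos_Ints_cases simp: Gamma_one_half_real)
  have ev: "eventually (\<lambda>s. ?f s = c_const 1 s) (at_right 0)"
    unfolding eventually_at_right_field
    by (intro exI[of _ 1] conjI allI impI zero_less_one c_const_eq[symmetric]) simp_all
  have "(c_const 1 \<longlongrightarrow> ?f 0) (at_right 0)"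
    by (rule Lim_transform_eventually[OF lim ev])
  moreover have "?f 0 = c_const 1 0" by (rule c_const_eq[symmetric]) simp_all
  ultimately show ?thesis by (simp only:)
qed

definition cutoff_profile :: "real \<Rightarrow> real \<Rightarrow> (real \<Rightarrow> real) \<Rightarrow> bool" where
  "cutoff_profile \<delta> b0 w0 \<longleftrightarrow>
     w0 \<in> Cc_inf {0..} \<and> (\<forall>t\<ge>0. w0 t \<ge> 0) \<and> antimono_on {0..} w0 \<and>
     supp_on w0 {0..} \<subseteq> {0..<\<delta>} \<and>
     0 < b0 \<and> b0 < 1 \<and> (\<forall>t\<in>{0..b0 * \<delta>}. w0 t = (SUP r\<in>{0..}. w0 r))"

definition nbhd :: "(real^'n) set \<Rightarrow> real \<Rightarrow> (real^'n) set" where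
  "nbhd \<Omega> \<delta> = {x + z | x z. x \<in> \<Omega> \<and> z \<in> ball 0 \<delta>}"

definition collar :: "(real^'n) set \<Rightarrow> real \<Rightarrow> (real^'n) set" where
  "collar \<Omega> \<delta> = nbhd \<Omega> \<delta> - \<Omega>"

definition nl_grad ::
  "real \<Rightarrow> real \<Rightarrow> (real^'n \<Rightarrow> real) \<Rightarrow> (real^'n \<Rightarrow> real) \<Rightarrow> real^'n \<Rightarrow> real^'n" where
  "nl_grad s \<delta> w u x = c_const CARD('n) s *\<^sub>R
     (LINT y:ball x \<delta>|lborel.
        ((u x - u y) * w (x - y) / norm (x - y) powr (real CARD('n) + s + 1)) *\<^sub>R (x - y))"

definition nl_div ::
  "real \<Rightarrow> real \<Rightarrow> (real^'n \<Rightarrow> real) \<Rightarrow> (real^'n \<Rightarrow> real^'n) \<Rightarrow> real^'n \<Rightarrow> real" where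
  "nl_div s \<delta> w \<phi> x = - c_const CARD('n) s *
     Lim (at_right 0) (\<lambda>r. LINT y:ball x \<delta> - ball x r|lborel.
        ((\<phi> x + \<phi> y) \<bullet> (x - y)) / norm (x - y) powr (real CARD('n) + s + 1) * w (x - y))"

(* Singular of order n + s where x and y approach a common boundary point, hence not absolutely
   integrable over collar \<Omega> \<delta> \<times> \<Omega> for every bounded open \<Omega> (it is for, say, Lipschitz \<Omega>). The
   double integral therefore has to be read either under absolute integrability or as the
   principal value obtained by removing ball x r from the inner domain. *)
definition collar_integrand ::
  "real \<Rightarrow> (real^'n \<Rightarrow> real) \<Rightarrow> (real^'n \<Rightarrow> real) \<Rightarrow> (real^'n \<Rightarrow> real^'n) \<Rightarrow>
     real^'n \<Rightarrow> real^'n \<Rightarrow> real" where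
  "collar_integrand s w u \<phi> x y =
     ((u y *\<^sub>R \<phi> x + u x *\<^sub>R \<phi> y) /\<^sub>R norm (y - x)) \<bullet> ((y - x) /\<^sub>R norm (y - x)) *
     (w (x - y) / norm (y - x) powr (real CARD('n) - 1 + s))"

end

theory Submission
  imports Defs
begin

text \<open>The kernel \<open>K z = (w z / \<bar>z\<bar> powr (n + s + 1)) z\<close> is odd. Once it is cut off near the origin it
  is bounded and integrable with integral \<open>0\<close>, so the \<open>u x\<close> part of the gradient and the \<open>\<phi> x\<close> part of
  the divergence drop out. What remains on both sides is \<open>F x y = u x (\<phi> y \<bullet> K (x - y))\<close>, integrated
  with its arguments in opposite order. Fubini cancels the contributions of \<open>\<Omega> \<times> \<Omega>\<close>; those in
  which one point lies in the collar make up the boundary term. The cut-off is then removed by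
  dominated convergence: since \<open>u\<close> and \<open>\<phi>\<close> are Lipschitz, the singular integrands are dominated
  by \<open>\<bar>z\<bar>\<close> to the power \<open>1 - n - s\<close>, which is integrable near \<open>0\<close> as \<open>s < 1\<close>.\<close>

section \<open>Reflection of Lebesgue measure and dominated convergence as the parameter tends to 0
  from the right\<close>

lemma lborel_distr_diff: "distr lborel borel (\<lambda>y. x - y) = (lborel :: 'a::euclidean_space measure)"
  using lborel_affine[of "-1" x] by (simp add: density_1)

lemma integrable_lborel_diff:
  fixes f :: "'a::euclidean_space \<Rightarrow> 'b::{banach, second_countable_topology}"
  assumes "integrable lborel f"
  shows "integrable lborel (\<lambda>y. f (x - y))"
  by (rule integrable_distr[of "\<lambda>y. x - y" lborel borel]) (simp_all add: lborel_distr_diff assms)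

lemma integral_lborel_diff:
  fixes f :: "'a::euclidean_space \<Rightarrow> 'b::{banach, second_countable_topology}"
  assumes "f \<in> borel_measurable borel"
  shows "(\<integral>y. f (x - y) \<partial>lborel) = (\<integral>y. f y \<partial>lborel)"
  using integral_distr[of "\<lambda>y. x - y" lborel borel f] assms by (simp add: lborel_distr_diff)

text \<open>Replacing \<open>r\<close> by \<open>inverse r\<close> moves the limit to infinity. The
  bound for \<open>r > 0\<close> then holds eventually, and dominated convergence for a real
  parameter applies.\<close>

lemma integral_dominated_convergence_at_right:
  fixes s :: "real \<Rightarrow> 'a \<Rightarrow> 'b::{banach, second_countable_topology}"
  assumes "f \<in> borel_measurable M" and "\<And>r. s r \<in> borel_measurable M" and "integrable M g"
    and lim: "\<And>x. ((\<lambda>r. s r x) \<longlongrightarrow> f x) (at_right 0)"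
    and bound: "\<And>r x. r > 0 \<Longrightarrow> norm (s r x) \<le> g x"
  shows "((\<lambda>r. integral\<^sup>L M (s r)) \<longlongrightarrow> integral\<^sup>L M f) (at_right 0)"
  unfolding filterlim_at_right_to_top
proof (rule integral_dominated_convergence_at_top[where w = g])
  show "\<forall>\<^sub>F r in at_top. AE x in M. norm (s (inverse r) x) \<le> g x"
    using eventually_gt_at_top[of "0::real"] by eventually_elim (simp add: bound)
  show "AE x in M. ((\<lambda>r. s (inverse r) x) \<longlongrightarrow> f x) at_top"
    using lim by (simp add: filterlim_at_right_to_top)
qed (use assms in simp_all)

section \<open>Integrability of negative powers of the norm near the origin\<close>

text \<open>Dyadic decomposition: where the norm lies between \<open>r / 2 ^ Suc k\<close> and
  \<open>r / 2 ^ k\<close>, the power is at most its value at the inner radius. Multiplied by the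
  volume of the outer ball, these bounds form a geometric series.\<close>

lemma integrable_indicator_ball_norm_powr:
  fixes a r :: real
  assumes "0 \<le> a" "a < DIM('a)" "r > 0"
  shows "integrable lborel (\<lambda>z::'a::euclidean_space. indicator (ball 0 r) z * norm z powr - a)"
proof (rule integrableI_nonneg)
  have ball: "ball (0::'a) \<rho> \<in> sets lborel" for \<rho>
    by (simp only: sets_lborel borel_open open_ball)
  define V where "V = unit_ball_vol (real DIM('a))"
  \<comment> \<open>The ratio of the series: halving the radius multiplies the bound on the power by
    \<open>2 powr a\<close> and the volume by \<open>2 powr - DIM('a)\<close>. It is less than 1
    because \<open>a\<close> is less than the dimension.\<close>
  define q where "q = 2 powr (a - DIM('a))"
  have q: "0 < q" "q < 1" using assms(2) powr_less_mono[of "a - DIM('a)" 0 2] by (simp_all add: q_def)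
  have V: "0 \<le> V" by (simp add: V_def)
  define t where "t k = (r / 2 ^ Suc k) powr - a * (V * (r / 2 ^ k) ^ DIM('a))" for k
  have t: "t k = V * r ^ DIM('a) * (r / 2) powr - a * q ^ k" for k
  proof -
    have *: "x / 2 ^ k = x * 2 powr - real k" for x :: real
      by (simp add: powr_minus powr_realpow divide_inverse)
    have "(r / 2 ^ Suc k) powr - a = (r / 2 * 2 powr - real k) powr - a"
      unfolding *[symmetric] by simp
    also have "\<dots> = (r / 2) powr - a * 2 powr (real k * a)"
      using assms(3) by (subst powr_mult) (simp_all add: powr_powr)
    finally have 1: "(r / 2 ^ Suc k) powr - a = (r / 2) powr - a * 2 powr (real k * a)" .
    have 2: "(r / 2 ^ k) ^ DIM('a) = r ^ DIM('a) * 2 powr - (real k * DIM('a))"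
      unfolding * by (simp add: power_mult_distrib powr_power mult.commute)
    have 3: "q ^ k = 2 powr (real k * a) * 2 powr - (real k * DIM('a))"
      unfolding q_def by (simp add: powr_power algebra_simps flip: powr_add)
    show ?thesis unfolding t_def 1 2 3 by simp
  qed
  have sums: "summable t"
    unfolding t using q by (intro summable_mult summable_geometric) simp
  have tpos: "0 \<le> t k" for k using V assms(3) by (simp add: t_def)
  have "(\<integral>\<^sup>+ z. ennreal (indicator (ball 0 r) (z::'a) * norm z powr - a) \<partial>lborel) \<le>
      (\<integral>\<^sup>+ z. (\<Sum>k. ennreal ((r / 2 ^ Suc k) powr - a) * indicator (ball (0::'a) (r / 2 ^ k)) z) \<partial>lborel)"
  proof (rule nn_integral_mono)
    fix z :: 'a
    show "ennreal (indicator (ball 0 r) z * norm z powr - a) \<le>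
        (\<Sum>k. ennreal ((r / 2 ^ Suc k) powr - a) * indicator (ball 0 (r / 2 ^ k)) z)"
    proof (cases "z \<in> ball 0 r \<and> z \<noteq> 0")
      case True
      define P where "P k \<longleftrightarrow> r / 2 ^ Suc k \<le> norm z" for k
      have "eventually (\<lambda>k. r / 2 ^ k < norm z) sequentially"
        by (rule order_tendstoD(2)[OF LIMSEQ_divide_realpow_zero]) (use True in simp_all)
      then obtain n where n: "\<And>k. k \<ge> n \<Longrightarrow> r / 2 ^ k < norm z"
        unfolding eventually_sequentially by blast
      have "P n" unfolding P_def by (rule less_imp_le[OF n]) simp
      \<comment> \<open>The least such \<open>k\<close> finds the shell of \<open>z\<close>:
        \<open>P\<close> fails at the preceding index, which is the upper bound on the norm. For
        \<open>k = 0\<close> that bound is membership in the ball itself.\<close>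
      define k where "k = (LEAST k. P k)"
      have k: "P k" unfolding k_def by (rule LeastI[of P, OF \<open>P n\<close>])
      have "norm z < r / 2 ^ k"
      proof (cases k)
        case 0 then show ?thesis using True by simp
      next
        case (Suc j)
        then have "\<not> P j" using not_less_Least[of j P] by (simp add: k_def)
        then show ?thesis by (simp add: P_def Suc)
      qed
      then have "z \<in> ball 0 (r / 2 ^ k)" by simp
      have le: "norm z powr - a \<le> (r / 2 ^ Suc k) powr - a"
        using k assms True unfolding P_def by (intro powr_mono2') auto
      define h where "h j = ennreal ((r / 2 ^ Suc j) powr - a) * indicator (ball 0 (r / 2 ^ j)) z" for j
      have "ennreal (indicator (ball 0 r) z * norm z powr - a) = ennreal (norm z powr - a)"
        using True by simp
      also have "\<dots> \<le> ennreal ((r / 2 ^ Suc k) powr - a)"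
        using le by (rule ennreal_leI)
      also have "\<dots> = h k"
        unfolding h_def indicator_simps(1)[OF \<open>z \<in> ball 0 (r / 2 ^ k)\<close>] by (rule mult_1_right[symmetric])
      also have "h k = (\<Sum>j\<in>{k}. h j)" by simp
      also have "\<dots> \<le> (\<Sum>j. h j)" by (rule sum_le_suminf) simp_all
      finally show ?thesis unfolding h_def .
    next
      \<comment> \<open>At the origin the value of \<open>powr\<close> is 0 by convention, so the
        left-hand side vanishes there as well as outside the ball.\<close>
      case False
      then have "indicator (ball 0 r) z * norm z powr - a = 0" by (cases "z = 0") simp_all
      then show ?thesis by (simp only: ennreal_0 zero_le)
    qed
  qed
  also have "\<dots> = (\<Sum>k. \<integral>\<^sup>+ z. ennreal ((r / 2 ^ Suc k) powr - a) * indicator (ball (0::'a) (r / 2 ^ k)) z \<partial>lborel)"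
    by (rule nn_integral_suminf)
      (rule borel_measurable_times_ennreal[OF borel_measurable_const borel_measurable_indicator[OF ball]])
  also have "\<dots> = (\<Sum>k. ennreal (t k))"
  proof (rule arg_cong[where f = suminf], rule ext)
    fix k
    have "emeasure lborel (ball (0::'a) (r / 2 ^ k)) = ennreal (V * (r / 2 ^ k) ^ DIM('a))"
      unfolding V_def by (rule emeasure_ball) (use assms(3) in simp)
    moreover have "(\<integral>\<^sup>+ z. ennreal ((r / 2 ^ Suc k) powr - a) * indicator (ball (0::'a) (r / 2 ^ k)) z \<partial>lborel) =
        ennreal ((r / 2 ^ Suc k) powr - a) * emeasure lborel (ball (0::'a) (r / 2 ^ k))"
      by (rule nn_integral_cmult_indicator[OF ball])
    ultimately show "(\<integral>\<^sup>+ z. ennreal ((r / 2 ^ Suc k) powr - a) * indicator (ball (0::'a) (r / 2 ^ k)) z \<partial>lborel) =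
        ennreal (t k)"
      unfolding t_def by (simp only: ennreal_mult'[OF powr_ge_zero])
  qed
  also have "\<dots> < \<infinity>"
    using suminf_ennreal2[OF tpos sums] by simp
  finally show "(\<integral>\<^sup>+ z. ennreal (indicator (ball 0 r) (z::'a) * norm z powr - a) \<partial>lborel) < \<infinity>" .
  show "(\<lambda>z::'a. indicator (ball 0 r) z * norm z powr - a) \<in> borel_measurable lborel"
    by (rule borel_measurable_times[OF borel_measurable_indicator[OF ball]])
      (rule powr_real_measurable; simp)
qed simp

section \<open>Test functions are bounded and Lipschitz\<close>

text \<open>The support is closed, so \<open>f\<close> is identically 0 on a neighbourhood of
  \<open>x\<close>, and derivatives are unique.\<close>

lemma has_derivative_zero_outside_support:
  assumes f: "(f has_derivative f') (at x)" and x: "x \<notin> supp_on f UNIV"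
  shows "f' = (\<lambda>_. 0)"
proof (rule has_derivative_unique)
  show "(f has_derivative (\<lambda>_. 0)) (at x)"
  proof (rule has_derivative_transform_within_open)
    show "((\<lambda>_. 0) has_derivative (\<lambda>_. 0)) (at x)" by simp
    show "open (- supp_on f UNIV)" "x \<in> - supp_on f UNIV" using x by (auto simp: supp_on_def)
    show "0 = f y" if "y \<in> - supp_on f UNIV" for y
      using that closure_subset[of "{x. f x \<noteq> 0}"] by (auto simp: supp_on_def)
  qed
qed (fact f)

lemma bounded_range_compact_support:
  fixes g :: "'a::t2_space \<Rightarrow> 'b::real_normed_vector"
  assumes "compact K" "continuous_on UNIV g" "\<And>x. x \<notin> K \<Longrightarrow> g x = 0"
  obtains B where "\<And>x. norm (g x) \<le> B"
proof -
  have "bounded (g ` K)"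
    using assms by (intro compact_imp_bounded compact_continuous_image) (auto intro: continuous_on_subset)
  then obtain B where B: "\<And>x. x \<in> K \<Longrightarrow> norm (g x) \<le> B" by (auto simp: bounded_iff)
  have "norm (g x) \<le> max B 0" for x
    using B[of x] assms(3)[of x] by (cases "x \<in> K") auto
  then show ?thesis by (rule that)
qed

text \<open>Compact support bounds \<open>f\<close> and its directional derivatives, and the mean
  value inequality gives the Lipschitz constant. Continuity, the bound and the Lipschitz estimate
  are what the rest of the proof takes from the test functions.\<close>

lemma Cc_inf_bounded_lipschitz:
  fixes f :: "'a::euclidean_space \<Rightarrow> 'b::real_normed_vector"
  assumes "f \<in> Cc_inf UNIV"
  obtains B L where "continuous_on UNIV f" "\<And>x. norm (f x) \<le> B"
    "\<And>x y. norm (f x - f y) \<le> L * norm (x - y)"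
proof -
  have K: "compact (supp_on f UNIV)" and C: "Ck_on k f UNIV" for k
    using assms by (auto simp: Cc_inf_def smooth_on_def)
  have cont: "continuous_on UNIV f" using C[of 0] by simp
  have "f x = 0" if "x \<notin> supp_on f UNIV" for x
    using that closure_subset[of "{x. f x \<noteq> 0}"] by (auto simp: supp_on_def)
  from bounded_range_compact_support[OF K cont this]
  obtain B where B: "\<And>x. norm (f x) \<le> B" by blast
  from C[of 1] obtain f' where f': "\<And>x. (f has_derivative f' x) (at x)"
    and cf': "\<And>v. continuous_on UNIV (\<lambda>x. f' x v)" by auto
  \<comment> \<open>\<open>Ck_on\<close> controls the derivative one direction \<open>v\<close> at a
    time, so the bound depends on \<open>v\<close>. Summing over the basis then bounds the operator
    norm uniformly in \<open>x\<close>.\<close>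
  have "\<exists>B. \<forall>x. norm (f' x v) \<le> B" for v
    using bounded_range_compact_support[OF K cf'[of v]] has_derivative_zero_outside_support[OF f']
    by metis
  then obtain D where D: "\<And>x v. norm (f' x v) \<le> D v" by metis
  have "norm (f x - f y) \<le> (\<Sum>i\<in>Basis. D i) * norm (x - y)" for x y
  proof (rule differentiable_bound[of UNIV])
    show "onorm (f' z) \<le> (\<Sum>i\<in>Basis. D i)" for z
      using onorm_componentwise[OF has_derivative_bounded_linear[OF f'[of z]]] D
      by (meson order_trans sum_mono)
  qed (use f' in auto)
  with cont B show ?thesis by (rule that)
qed

section \<open>Geometry and measurability of the collar\<close>

text \<open>This form makes openness of the neighbourhood evident and turns membership in the collar
  into a condition on distances.\<close>

lemma nbhd_eq_UN_ball: "nbhd \<Omega> \<delta> = (\<Union>x\<in>\<Omega>. ball x \<delta>)"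
proof -
  have "y \<in> nbhd \<Omega> \<delta>" if "x \<in> \<Omega>" "y \<in> ball x \<delta>" for x y
    using that unfolding nbhd_def by (intro CollectI exI[of _ x] exI[of _ "y - x"]) (simp add: dist_norm norm_minus_commute)
  then show ?thesis by (auto simp: nbhd_def dist_norm)
qed

lemma bounded_nbhd:
  assumes "bounded \<Omega>"
  shows "bounded (nbhd \<Omega> \<delta>)"
proof -
  obtain R where R: "\<And>x. x \<in> \<Omega> \<Longrightarrow> norm x \<le> R" using assms by (auto simp: bounded_iff)
  have "norm (x + z) \<le> R + \<delta>" if "x \<in> \<Omega>" "norm z < \<delta>" for x z
    using norm_triangle_ineq[of x z] R[OF that(1)] that(2) by linarith
  then show ?thesis by (auto simp: nbhd_def bounded_iff intro!: exI[of _ "R + \<delta>"])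
qed

lemma collar_measurable [measurable]:
  assumes [measurable]: "\<Omega> \<in> sets borel"
  shows "collar \<Omega> \<delta> \<in> sets borel"
proof -
  have "open (nbhd \<Omega> \<delta>)" by (auto simp: nbhd_eq_UN_ball)
  then have [measurable]: "nbhd \<Omega> \<delta> \<in> sets borel" by (rule borel_open)
  show ?thesis by (simp add: collar_def)
qed

section \<open>Integration by parts for bounded odd kernels\<close>

text \<open>Reflection in the origin preserves Lebesgue measure, so oddness makes the integral equal
  to its own negative.\<close>

lemma integral_odd_diff_eq_0:
  fixes K :: "'a::euclidean_space \<Rightarrow> 'b::{banach, second_countable_topology}"
  assumes "K \<in> borel_measurable borel" and odd: "\<And>z. K (- z) = - K z"
  shows "(\<integral>y. K (x - y) \<partial>lborel) = 0"
proof -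
  have "(\<integral>y. K y \<partial>lborel) = (\<integral>y. K (0 - y) \<partial>lborel)"
    using integral_lborel_diff[OF assms(1), of 0] by simp
  also have "\<dots> = - (\<integral>y. K y \<partial>lborel)" by (simp add: odd)
  finally have "2 *\<^sub>R (\<integral>y. K y \<partial>lborel) = 0" by (simp add: scaleR_2 eq_neg_iff_add_eq_0)
  then show ?thesis by (simp add: integral_lborel_diff[OF assms(1)])
qed

text \<open>The integrand is bounded by \<open>U * B\<close> and vanishes outside
  \<open>ball x \<delta>\<close>, a set of finite measure.\<close>

lemma integrable_times_kernel:
  fixes K :: "'a::euclidean_space \<Rightarrow> 'a" and u :: "'a \<Rightarrow> real"
  assumes [measurable]: "u \<in> borel_measurable borel" "K \<in> borel_measurable borel"
    and "\<And>x. norm (u x) \<le> U" "\<And>z. norm (K z) \<le> B" and "\<And>z. norm z \<ge> \<delta> \<Longrightarrow> K z = 0"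
  shows "integrable lborel (\<lambda>y. u y *\<^sub>R K (x - y))"
proof (rule integrableI_bounded_set[where A = "ball x \<delta>" and B = "U * B"])
  have "norm (u y *\<^sub>R K (x - y)) \<le> U * B" for y
    using mult_mono[OF assms(3)[of y] assms(4)[of "x - y"]] order_trans[OF norm_ge_zero assms(3)] by simp
  then show "AE y in lborel. y \<in> ball x \<delta> \<longrightarrow> norm (u y *\<^sub>R K (x - y)) \<le> U * B" by simp
  show "AE y in lborel. y \<notin> ball x \<delta> \<longrightarrow> u y *\<^sub>R K (x - y) = 0"
    using assms(5) by (auto simp: dist_norm)
  show "emeasure lborel (ball x \<delta>) < \<infinity>" by (rule emeasure_bounded_finite) simp
qed simp_all

lemma integrable_inner_kernel:
  fixes K :: "'a::euclidean_space \<Rightarrow> 'a" and \<phi> :: "'a \<Rightarrow> 'a"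
  assumes [measurable]: "\<phi> \<in> borel_measurable borel" "K \<in> borel_measurable borel"
    and "\<And>x. norm (\<phi> x) \<le> P" "\<And>z. norm (K z) \<le> B" and "\<And>z. norm z \<ge> \<delta> \<Longrightarrow> K z = 0"
  shows "integrable lborel (\<lambda>y. \<phi> y \<bullet> K (x - y))"
proof (rule integrableI_bounded_set[where A = "ball x \<delta>" and B = "P * B"])
  have "norm (\<phi> y \<bullet> K (x - y)) \<le> P * B" for y
    using Cauchy_Schwarz_ineq2[of "\<phi> y" "K (x - y)"]
      mult_mono[OF assms(3)[of y] assms(4)[of "x - y"]] order_trans[OF norm_ge_zero assms(3)]
    by simp
  then show "AE y in lborel. y \<in> ball x \<delta> \<longrightarrow> norm (\<phi> y \<bullet> K (x - y)) \<le> P * B" by simp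
  show "AE y in lborel. y \<notin> ball x \<delta> \<longrightarrow> \<phi> y \<bullet> K (x - y) = 0"
    using assms(5) by (auto simp: dist_norm)
  show "emeasure lborel (ball x \<delta>) < \<infinity>" by (rule emeasure_bounded_finite) simp
qed simp_all

text \<open>Oddness removes the term with the constant vector \<open>\<phi> x\<close>. The factor
  \<open>c\<close> lets one statement cover both the sum \<open>\<phi> x + \<phi> y\<close> and the
  difference \<open>\<phi> x - \<phi> y\<close>.\<close>

lemma integral_plus_odd_kernel:
  fixes K :: "'a::euclidean_space \<Rightarrow> 'a" and \<phi> :: "'a \<Rightarrow> 'a"
  assumes [measurable]: "\<phi> \<in> borel_measurable borel" "K \<in> borel_measurable borel"
    and "\<And>x. norm (\<phi> x) \<le> P" "\<And>z. norm (K z) \<le> B" "\<And>z. norm z \<ge> \<delta> \<Longrightarrow> K z = 0"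
    and odd: "\<And>z. K (- z) = - K z"
  shows "(\<integral>y. (\<phi> x + c *\<^sub>R \<phi> y) \<bullet> K (x - y) \<partial>lborel) = c * (\<integral>y. \<phi> y \<bullet> K (x - y) \<partial>lborel)"
proof -
  have i: "integrable lborel (\<lambda>y. \<phi> y \<bullet> K (x - y))"
    by (rule integrable_inner_kernel[where \<delta> = \<delta>]) (use assms in auto)
  have "integrable lborel (\<lambda>y. 1 *\<^sub>R K (x - y))"
    by (rule integrable_times_kernel[where \<delta> = \<delta> and U = 1]) (use assms in auto)
  then have j: "integrable lborel (\<lambda>y. K (x - y))" by simp
  have "(\<integral>y. \<phi> x \<bullet> K (x - y) \<partial>lborel) = 0"
    using j integral_odd_diff_eq_0[OF assms(2) odd, of x] by simp
  then show ?thesis using i j by (simp add: inner_add_left)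
qed

text \<open>Every term reduces to double integrals of the single function \<open>F\<close> over
  products of \<Omega> and the collar. Boundedness of \<open>K\<close> makes \<open>F\<close>
  integrable on bounded products, which justifies Fubini.\<close>

lemma bounded_kernel_integration_by_parts:
  fixes \<Omega> :: "(real^'n) set" and u :: "real^'n \<Rightarrow> real" and \<phi> K :: "real^'n \<Rightarrow> real^'n"
  assumes \<Omega>[measurable]: "\<Omega> \<in> sets borel" and "bounded \<Omega>"
    and u[measurable]: "u \<in> borel_measurable borel" and \<phi>[measurable]: "\<phi> \<in> borel_measurable borel"
    and K[measurable]: "K \<in> borel_measurable borel"
    and U: "\<And>x. norm (u x) \<le> U" and P: "\<And>x. norm (\<phi> x) \<le> P" and B: "\<And>z. norm (K z) \<le> B"
    and odd: "\<And>z. K (- z) = - K z" and K0: "\<And>z. norm z \<ge> \<delta> \<Longrightarrow> K z = 0"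
  shows "(LINT x:\<Omega>|lborel. (\<integral>y. (u x - u y) *\<^sub>R K (x - y) \<partial>lborel) \<bullet> \<phi> x) =
    - (LINT x:\<Omega>|lborel. u x * (\<integral>y. (\<phi> x - \<phi> y) \<bullet> K (x - y) \<partial>lborel))
    - (LINT x:collar \<Omega> \<delta>|lborel. LINT y:\<Omega>|lborel. (u y *\<^sub>R \<phi> x + u x *\<^sub>R \<phi> y) \<bullet> K (y - x))"
proof -
  let ?C = "collar \<Omega> \<delta>"
  define F where "F x y = u x * (\<phi> y \<bullet> K (x - y))" for x y
  have [measurable]: "(\<lambda>(x, y). F x y) \<in> borel_measurable (lborel \<Otimes>\<^sub>M lborel)"
    unfolding F_def by measurable
  have "bounded ?C"
    using bounded_nbhd[OF assms(2)] by (auto simp: collar_def intro: bounded_subset)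
  have odd': "K (y - x) = - K (x - y)" for x y using odd[of "x - y"] by simp
  have F_bound: "norm (F x y) \<le> U * (P * B)" for x y
  proof -
    have "0 \<le> U" "0 \<le> P" using norm_ge_zero U P order_trans by blast+
    moreover have "\<bar>\<phi> y \<bullet> K (x - y)\<bar> \<le> P * B"
      using Cauchy_Schwarz_ineq2[of "\<phi> y" "K (x - y)"] mult_mono[OF P[of y] B[of "x - y"] \<open>0 \<le> P\<close>]
      by simp
    ultimately show ?thesis using U[of x] by (simp add: F_def abs_mult mult_mono)
  qed
  have int: "integrable (lborel \<Otimes>\<^sub>M lborel) (\<lambda>(x, y). indicator A x * indicator A' y * F x y)"
    if [measurable]: "A \<in> sets borel" "A' \<in> sets borel" and b: "bounded A" "bounded A'" for A A'
  proof -
    have "integrable (lborel \<Otimes>\<^sub>M lborel) (\<lambda>z. indicator (A \<times> A') z *\<^sub>R (case z of (x, y) \<Rightarrow> F x y))"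
    proof (rule integrableI_bounded_set_indicator[where B = "U * (P * B)"])
      show "emeasure (lborel \<Otimes>\<^sub>M lborel) (A \<times> A') < \<infinity>"
        using emeasure_bounded_finite[OF b(1)] emeasure_bounded_finite[OF b(2)]
        by (simp add: lborel.emeasure_pair_measure_Times ennreal_mult_less_top)
    qed (use F_bound in \<open>auto simp del: real_norm_def\<close>)
    moreover have "(\<lambda>z. indicator (A \<times> A') z *\<^sub>R (case z of (x, y) \<Rightarrow> F x y)) =
        (\<lambda>(x, y). indicator A x * indicator A' y * F x y)"
      by (auto simp: fun_eq_iff indicator_def)
    ultimately show ?thesis by simp
  qed
  \<comment> \<open>In \<open>J A A'\<close> the function \<open>u\<close> is evaluated on
    \<open>A\<close> and \<open>\<phi>\<close> on \<open>A'\<close>. Exchanging the order of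
    integration therefore exchanges the two sets.\<close>
  define J where "J A A' = (\<integral>x. \<integral>y. indicator A x * indicator A' y * F x y \<partial>lborel \<partial>lborel)" for A A'
  have J_swap: "(\<integral>x. \<integral>y. indicator A x * indicator A' y * F y x \<partial>lborel \<partial>lborel) = J A' A"
    if "A \<in> sets borel" "A' \<in> sets borel" "bounded A" "bounded A'" for A A'
    using lborel_pair.Fubini_integral[OF int[OF that(2,1,4,3)]] by (simp add: J_def mult_ac)
  note meas = \<Omega> collar_measurable[OF \<Omega>, of \<delta>]
  note bd = \<open>bounded \<Omega>\<close> \<open>bounded ?C\<close>
  \<comment> \<open>If \<open>x\<close> lies in \<Omega> and \<open>y\<close> in neither \<Omega>
    nor the collar, their distance is at least \<delta> and \<open>f y\<close> vanishes. An inner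
    integral over the whole space thus splits into one over \<Omega> and one over the
    collar.\<close>
  have split: "indicator \<Omega> x * f y = indicator \<Omega> x * indicator \<Omega> y * f y + indicator \<Omega> x * indicator ?C y * f y"
    if "norm (x - y) \<ge> \<delta> \<Longrightarrow> f y = 0" for x y and f :: "real^'n \<Rightarrow> real"
  proof (cases "x \<in> \<Omega> \<and> y \<notin> \<Omega>")
    case True
    then have "y \<in> ?C" if "norm (x - y) < \<delta>"
      using that by (auto simp: collar_def nbhd_eq_UN_ball dist_norm)
    with True that show ?thesis by (cases "norm (x - y) < \<delta>") auto
  qed (auto simp: indicator_def collar_def)
  have iF1: "integrable lborel (\<lambda>x. \<integral>y. indicator A x * indicator A' y * F x y \<partial>lborel)"
    and iF2: "integrable lborel (\<lambda>x. \<integral>y. indicator A x * indicator A' y * F y x \<partial>lborel)"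
    and AE1: "AE x in lborel. integrable lborel (\<lambda>y. indicator A x * indicator A' y * F x y)"
    and AE2: "AE x in lborel. integrable lborel (\<lambda>y. indicator A x * indicator A' y * F y x)"
    if "A \<in> sets borel" "A' \<in> sets borel" "bounded A" "bounded A'" for A A'
  proof -
    note i1 = int[OF that]
    have i2: "integrable (lborel \<Otimes>\<^sub>M lborel) (\<lambda>(x, y). indicator A x * indicator A' y * F y x)"
      using lborel_pair.integrable_product_swap[OF int[OF that(2,1,4,3)]] by (simp add: mult_ac)
    show "integrable lborel (\<lambda>x. \<integral>y. indicator A x * indicator A' y * F x y \<partial>lborel)"
      "integrable lborel (\<lambda>x. \<integral>y. indicator A x * indicator A' y * F y x \<partial>lborel)"
      using lborel_pair.integrable_fst'[OF i1] lborel_pair.integrable_fst'[OF i2] by simp_all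
    show "AE x in lborel. integrable lborel (\<lambda>y. indicator A x * indicator A' y * F x y)"
      "AE x in lborel. integrable lborel (\<lambda>y. indicator A x * indicator A' y * F y x)"
      using lborel_pair.AE_integrable_fst'[OF i1] lborel_pair.AE_integrable_fst'[OF i2] by simp_all
  qed
  \<comment> \<open>The term with \<open>u x\<close> integrates to 0. The minus sign of the
    remaining one is absorbed by oddness, which turns \<open>K (x - y)\<close> into
    \<open>K (y - x)\<close>, the kernel of \<open>F y x\<close>.\<close>
  have "(\<integral>y. (u x - u y) *\<^sub>R K (x - y) \<partial>lborel) \<bullet> \<phi> x = (\<integral>y. F y x \<partial>lborel)" for x
  proof -
    have i: "integrable lborel (\<lambda>y. u y *\<^sub>R K (x - y))"
      by (rule integrable_times_kernel[where \<delta> = \<delta>]) (use assms in auto)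
    have "integrable lborel (\<lambda>y. 1 *\<^sub>R K (x - y))"
      by (rule integrable_times_kernel[where \<delta> = \<delta> and U = 1]) (use assms in auto)
    then have j: "integrable lborel (\<lambda>y. K (x - y))" by simp
    have "(\<integral>y. (u x - u y) *\<^sub>R K (x - y) \<partial>lborel) = - (\<integral>y. u y *\<^sub>R K (x - y) \<partial>lborel)"
      using i j integral_odd_diff_eq_0[OF K odd, of x] by (simp add: scaleR_diff_left)
    also have "\<dots> \<bullet> \<phi> x = - (\<integral>y. (u y *\<^sub>R K (x - y)) \<bullet> \<phi> x \<partial>lborel)"
      using integral_inner_left[of "\<phi> x", OF i] by (simp del: inner_scaleR_left)
    also have "\<dots> = (\<integral>y. F y x \<partial>lborel)"
      by (simp add: F_def odd'[of _ x] inner_commute flip: integral_minus)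
    finally show ?thesis .
  qed
  then have "(LINT x:\<Omega>|lborel. (\<integral>y. (u x - u y) *\<^sub>R K (x - y) \<partial>lborel) \<bullet> \<phi> x) =
      (\<integral>x. (\<integral>y. indicator \<Omega> x * F y x \<partial>lborel) \<partial>lborel)"
    by (simp add: set_lebesgue_integral_def)
  also have "\<dots> = (\<integral>x. (\<integral>y. indicator \<Omega> x * indicator \<Omega> y * F y x \<partial>lborel) +
       (\<integral>y. indicator \<Omega> x * indicator ?C y * F y x \<partial>lborel) \<partial>lborel)"
  proof (rule integral_cong_AE)
    show "AE x in lborel. (\<integral>y. indicator \<Omega> x * F y x \<partial>lborel) =
       (\<integral>y. indicator \<Omega> x * indicator \<Omega> y * F y x \<partial>lborel) +
       (\<integral>y. indicator \<Omega> x * indicator ?C y * F y x \<partial>lborel)"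
      using AE2[OF meas(1,1) bd(1,1)] AE2[OF meas bd]
    proof eventually_elim
      case (elim x)
      have "indicator \<Omega> x * F y x =
          indicator \<Omega> x * indicator \<Omega> y * F y x + indicator \<Omega> x * indicator ?C y * F y x" for y
        by (rule split[where f = "\<lambda>y. F y x"]) (simp add: F_def K0 norm_minus_commute)
      then show ?case using elim by simp
    qed
  qed measurable
  also have "\<dots> = J \<Omega> \<Omega> + J ?C \<Omega>"
    using Bochner_Integration.integral_add[OF iF2[OF meas(1,1) bd(1,1)] iF2[OF meas bd]]
    by (simp only: J_swap[OF meas(1,1) bd(1,1)] J_swap[OF meas bd])
  finally have lhs: "(LINT x:\<Omega>|lborel. (\<integral>y. (u x - u y) *\<^sub>R K (x - y) \<partial>lborel) \<bullet> \<phi> x) = J \<Omega> \<Omega> + J ?C \<Omega>" .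

  have "u x * (\<integral>y. (\<phi> x - \<phi> y) \<bullet> K (x - y) \<partial>lborel) = - (\<integral>y. F x y \<partial>lborel)" for x
    using integral_plus_odd_kernel[OF \<phi> K P B K0 odd, where c = "-1" and x = x] by (simp add: F_def)
  then have "- (LINT x:\<Omega>|lborel. u x * (\<integral>y. (\<phi> x - \<phi> y) \<bullet> K (x - y) \<partial>lborel)) =
      (\<integral>x. (\<integral>y. indicator \<Omega> x * F x y \<partial>lborel) \<partial>lborel)"
    by (simp add: set_lebesgue_integral_def)
  also have "\<dots> = (\<integral>x. (\<integral>y. indicator \<Omega> x * indicator \<Omega> y * F x y \<partial>lborel) +
       (\<integral>y. indicator \<Omega> x * indicator ?C y * F x y \<partial>lborel) \<partial>lborel)"
  proof (rule integral_cong_AE)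
    show "AE x in lborel. (\<integral>y. indicator \<Omega> x * F x y \<partial>lborel) =
       (\<integral>y. indicator \<Omega> x * indicator \<Omega> y * F x y \<partial>lborel) +
       (\<integral>y. indicator \<Omega> x * indicator ?C y * F x y \<partial>lborel)"
      using AE1[OF meas(1,1) bd(1,1)] AE1[OF meas bd]
    proof eventually_elim
      case (elim x)
      have "indicator \<Omega> x * F x y =
          indicator \<Omega> x * indicator \<Omega> y * F x y + indicator \<Omega> x * indicator ?C y * F x y" for y
        by (rule split[where f = "\<lambda>y. F x y"]) (simp add: F_def K0)
      then show ?case using elim by simp
    qed
  qed measurable
  also have "\<dots> = J \<Omega> \<Omega> + J \<Omega> ?C"
    using Bochner_Integration.integral_add[OF iF1[OF meas(1,1) bd(1,1)] iF1[OF meas bd]]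
    by (simp only: J_def)
  finally have rhs: "- (LINT x:\<Omega>|lborel. u x * (\<integral>y. (\<phi> x - \<phi> y) \<bullet> K (x - y) \<partial>lborel)) =
      J \<Omega> \<Omega> + J \<Omega> ?C" .

  \<comment> \<open>Oddness gives the two summands opposite signs when each is written through
    \<open>F\<close>.\<close>
  have "(u y *\<^sub>R \<phi> x + u x *\<^sub>R \<phi> y) \<bullet> K (y - x) = F y x - F x y" for x y
    by (simp add: F_def odd'[of y x] inner_add_left)
  then have "(LINT x:?C|lborel. LINT y:\<Omega>|lborel. (u y *\<^sub>R \<phi> x + u x *\<^sub>R \<phi> y) \<bullet> K (y - x)) =
      (\<integral>x. (\<integral>y. indicator ?C x * indicator \<Omega> y * F y x - indicator ?C x * indicator \<Omega> y * F x y \<partial>lborel) \<partial>lborel)"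
    by (simp add: set_lebesgue_integral_def mult.assoc flip: right_diff_distrib)
  also have "\<dots> = (\<integral>x. (\<integral>y. indicator ?C x * indicator \<Omega> y * F y x \<partial>lborel) -
       (\<integral>y. indicator ?C x * indicator \<Omega> y * F x y \<partial>lborel) \<partial>lborel)"
  proof (rule integral_cong_AE)
    show "AE x in lborel. (\<integral>y. indicator ?C x * indicator \<Omega> y * F y x - indicator ?C x * indicator \<Omega> y * F x y \<partial>lborel) =
       (\<integral>y. indicator ?C x * indicator \<Omega> y * F y x \<partial>lborel) -
       (\<integral>y. indicator ?C x * indicator \<Omega> y * F x y \<partial>lborel)"
      using AE1[OF meas(2,1) bd(2,1)] AE2[OF meas(2,1) bd(2,1)] by eventually_elim simp
  qed measurable
  also have "\<dots> = (\<integral>x. (\<integral>y. indicator ?C x * indicator \<Omega> y * F y x \<partial>lborel) \<partial>lborel) -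
       (\<integral>x. (\<integral>y. indicator ?C x * indicator \<Omega> y * F x y \<partial>lborel) \<partial>lborel)"
    by (rule Bochner_Integration.integral_diff[OF iF2[OF meas(2,1) bd(2,1)] iF1[OF meas(2,1) bd(2,1)]])
  finally have coll: "(LINT x:?C|lborel. LINT y:\<Omega>|lborel. (u y *\<^sub>R \<phi> x + u x *\<^sub>R \<phi> y) \<bullet> K (y - x)) =
      J \<Omega> ?C - J ?C \<Omega>"
    unfolding J_swap[OF meas(2,1) bd(2,1)] J_def[of ?C \<Omega>, symmetric] .
  \<comment> \<open>The two occurrences of \<open>J \<Omega> ?C\<close> cancel, and what is left is
    \<open>J \<Omega> \<Omega> + J ?C \<Omega>\<close> on both sides.\<close>
  show ?thesis unfolding lhs rhs coll by simp
qed

section \<open>Truncated kernels and removal of the truncation\<close>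

text \<open>An open ball is removed, which is empty for \<open>r = 0\<close>. Hence
  \<open>truncate 0 K\<close> is \<open>K\<close>, and facts proved for every \<open>r\<close>
  include the singular kernel.\<close>

definition truncate :: "real \<Rightarrow> ('a::real_normed_vector \<Rightarrow> 'b::real_vector) \<Rightarrow> 'a \<Rightarrow> 'b" where
  "truncate r K z = indicator (- ball 0 r) z *\<^sub>R K z"

lemma truncate_measurable [measurable]:
  fixes K :: "'a::euclidean_space \<Rightarrow> 'b::{real_normed_vector, second_countable_topology}"
  assumes [measurable]: "K \<in> borel_measurable borel"
  shows "truncate r K \<in> borel_measurable borel"
proof -
  have "- ball (0::'a) r \<in> sets borel" by (intro borel_closed closed_Compl open_ball)
  then show ?thesis
    unfolding truncate_def[abs_def] by (intro borel_measurable_scaleR borel_measurable_indicator assms)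
qed

lemma norm_truncate_le: "norm (truncate r K z) \<le> norm (K z)"
  by (simp add: truncate_def indicator_def)

lemma truncate_nonpos: "r \<le> 0 \<Longrightarrow> truncate r K = K"
  by (simp add: truncate_def fun_eq_iff ball_empty)

lemma truncate_tendsto:
  fixes K :: "'a::real_normed_vector \<Rightarrow> 'b::real_normed_vector"
  assumes "z \<noteq> 0"
  shows "((\<lambda>r. truncate r K z) \<longlongrightarrow> K z) (at_right 0)"
proof (rule tendsto_eventually)
  show "\<forall>\<^sub>F r in at_right 0. truncate r K z = K z"
    using assms unfolding eventually_at_right_field
    by (intro exI[of _ "norm z"]) (auto simp: truncate_def)
qed

text \<open>Stated for both products at once: scaling for the gradient, the inner product for the
  divergence.\<close>

lemma
  fixes f :: "'a::euclidean_space \<Rightarrow> 'b::{real_normed_vector, second_countable_topology}"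
    and p :: "'b \<Rightarrow> 'a \<Rightarrow> 'c::{banach, second_countable_topology}"
  assumes cont: "continuous_on UNIV (\<lambda>(a, b). p a b)" and p: "\<And>a b. norm (p a b) \<le> norm a * norm b"
    and [measurable]: "f \<in> borel_measurable borel" "K \<in> borel_measurable borel"
    and L: "\<And>x y. norm (f x - f y) \<le> L * norm (x - y)"
    and KG: "\<And>z. norm z * norm (K z) \<le> G z" and G: "integrable lborel G"
  shows integral_diff_truncate_measurable:
      "(\<lambda>x. \<integral>y. p (f x - f y) (truncate r K (x - y)) \<partial>lborel) \<in> borel_measurable borel"
    and integral_diff_measurable:
      "(\<lambda>x. \<integral>y. p (f x - f y) (K (x - y)) \<partial>lborel) \<in> borel_measurable borel"
    and norm_integral_diff_truncate_le:
      "norm (\<integral>y. p (f x - f y) (truncate r K (x - y)) \<partial>lborel) \<le> \<bar>L\<bar> * integral\<^sup>L lborel G"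
    and integral_diff_truncate_tendsto:
      "((\<lambda>r. \<integral>y. p (f x - f y) (truncate r K (x - y)) \<partial>lborel) \<longlongrightarrow>
         (\<integral>y. p (f x - f y) (K (x - y)) \<partial>lborel)) (at_right 0)"
proof -
  have "(\<lambda>(a, b). p a b) \<in> borel_measurable (borel \<Otimes>\<^sub>M borel)"
    unfolding borel_prod by (rule borel_measurable_continuous_onI[OF cont])
  note p_meas = measurable_compose[OF measurable_Pair this, unfolded prod.case]
  have "(\<lambda>(x, y). p (f x - f y) (truncate r K (x - y))) \<in> borel_measurable (borel \<Otimes>\<^sub>M lborel)" for r
    unfolding split_beta' by (rule p_meas) measurable
  then show meas:
    "(\<lambda>x. \<integral>y. p (f x - f y) (truncate r K (x - y)) \<partial>lborel) \<in> borel_measurable borel" for r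
    by (rule lborel.borel_measurable_lebesgue_integral)
  show "(\<lambda>x. \<integral>y. p (f x - f y) (K (x - y)) \<partial>lborel) \<in> borel_measurable borel"
    using meas[of 0] unfolding truncate_nonpos[OF order_refl] .
  have meas1: "(\<lambda>y. p (f x - f y) (truncate r K (x - y))) \<in> borel_measurable lborel" for x r
    by (rule p_meas) measurable
  \<comment> \<open>The Lipschitz estimate supplies the factor \<open>norm (x - y)\<close> that
    tames the kernel. The majorant does not depend on \<open>r\<close>; the absolute value covers a
    negative \<open>L\<close>.\<close>
  have bound: "norm (p (f x - f y) (truncate r K (x - y))) \<le> \<bar>L\<bar> * G (x - y)" for x y r
  proof -
    have "norm (p (f x - f y) (truncate r K (x - y))) \<le> norm (f x - f y) * norm (truncate r K (x - y))"
      by (rule p)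
    also have "\<dots> \<le> (\<bar>L\<bar> * norm (x - y)) * norm (K (x - y))"
      by (intro mult_mono norm_truncate_le order_trans[OF L mult_right_mono[OF abs_ge_self norm_ge_zero]])
        simp_all
    also have "\<dots> \<le> \<bar>L\<bar> * G (x - y)"
      using KG[of "x - y"] by (simp add: mult.assoc mult_left_mono)
    finally show ?thesis .
  qed
  have int: "integrable lborel (\<lambda>y. \<bar>L\<bar> * G (x - y))" for x
    using integrable_lborel_diff[OF G] by simp
  have "norm (\<integral>y. p (f x - f y) (truncate r K (x - y)) \<partial>lborel) \<le> (\<integral>y. \<bar>L\<bar> * G (x - y) \<partial>lborel)" for r
    by (rule Bochner_Integration.integral_norm_bound_integral[OF _ int bound])
      (rule Bochner_Integration.integrable_bound[OF int[of x] meas1 AE_I2],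
       simp only: real_norm_def, rule order_trans[OF bound abs_ge_self])
  also have "(\<integral>y. \<bar>L\<bar> * G (x - y) \<partial>lborel) = \<bar>L\<bar> * integral\<^sup>L lborel G"
    using G by (simp add: integral_lborel_diff)
  finally show "norm (\<integral>y. p (f x - f y) (truncate r K (x - y)) \<partial>lborel) \<le> \<bar>L\<bar> * integral\<^sup>L lborel G" .
  show "((\<lambda>r. \<integral>y. p (f x - f y) (truncate r K (x - y)) \<partial>lborel) \<longlongrightarrow>
         (\<integral>y. p (f x - f y) (K (x - y)) \<partial>lborel)) (at_right 0)"
  proof (rule integral_dominated_convergence_at_right[OF _ _ int[of x] _ bound])
    show "(\<lambda>y. p (f x - f y) (K (x - y))) \<in> borel_measurable lborel"
      using meas1[of x 0] unfolding truncate_nonpos[OF order_refl] .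
    fix y
    \<comment> \<open>At \<open>y = x\<close> the truncated kernels need not converge to
      \<open>K 0\<close>, but there the factor \<open>f x - f y\<close> is 0 and so is the
      product.\<close>
    have "p 0 b = 0" for b using p[of 0 b] by simp
    moreover have "((\<lambda>r. p (f x - f y) (truncate r K (x - y))) \<longlongrightarrow> p (f x - f y) (K (x - y))) (at_right 0)"
      if "x \<noteq> y"
      using continuous_on_tendsto_compose[OF cont tendsto_Pair[OF tendsto_const truncate_tendsto[of "x - y" K]],
          of "f x - f y"] that by simp
    ultimately show "((\<lambda>r. p (f x - f y) (truncate r K (x - y))) \<longlongrightarrow> p (f x - f y) (K (x - y))) (at_right 0)"
      by (cases "x = y") simp_all
  qed (rule meas1)
qed

section \<open>The kernel shared by the nonlocal gradient and divergence\<close>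

definition riesz_kernel :: "real \<Rightarrow> (real^'n \<Rightarrow> real) \<Rightarrow> real^'n \<Rightarrow> real^'n" where
  "riesz_kernel s w z = (w z / norm z powr (real CARD('n) + s + 1)) *\<^sub>R z"

lemma norm_riesz_kernel:
  fixes z :: "real^'n"
  shows "norm (riesz_kernel s w z) = \<bar>w z\<bar> * norm z powr - (real CARD('n) + s)"
proof (cases "z = 0")
  case False
  then have eq: "norm z / norm z powr (real CARD('n) + s + 1) = norm z powr - (real CARD('n) + s)"
    using powr_diff[of "norm z" 1 "real CARD('n) + s + 1"] by simp
  have "norm (riesz_kernel s w z) = \<bar>w z\<bar> * (norm z / norm z powr (real CARD('n) + s + 1))"
    by (simp add: riesz_kernel_def)
  then show ?thesis by (simp only: eq)
qed (simp add: riesz_kernel_def)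

text \<open>The two normalisations contribute two powers of the distance to the denominator, which
  raise the exponent \<open>n - 1 + s\<close> to \<open>n + s + 1\<close>. Evenness of
  \<open>w\<close> is assumed because the integrand takes it at \<open>x - y\<close> and the kernel
  at \<open>y - x\<close>.\<close>

lemma collar_integrand_eq:
  fixes x y :: "real^'n"
  assumes "w (x - y) = w (y - x)"
  shows "collar_integrand s w u \<phi> x y = (u y *\<^sub>R \<phi> x + u x *\<^sub>R \<phi> y) \<bullet> riesz_kernel s w (y - x)"
proof (cases "x = y")
  case True
  then show ?thesis by (simp add: collar_integrand_def riesz_kernel_def)
next
  case False
  let ?d = "norm (y - x)" and ?n = "real CARD('n)"
  have "?d powr (?n + s + 1) = ?d powr (?n - 1 + s) * ?d powr 2"
    by (subst powr_add[symmetric]) (rule arg_cong[where f = "\<lambda>p. ?d powr p"], simp)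
  also have "?d powr 2 = ?d * ?d" using False by (simp add: power2_eq_square)
  finally have eq: "?d powr (?n + s + 1) = ?d powr (?n - 1 + s) * (?d * ?d)" .
  have alg: "inverse d * (inverse d * v) * (c / D) = c / (D * (d * d)) * v" for c d v D :: real
    by (simp add: divide_inverse)
  show ?thesis
    unfolding collar_integrand_def riesz_kernel_def eq assms inner_scaleR_left inner_scaleR_right
    by (rule alg)
qed

lemma continuous_on_inner_pair: "continuous_on UNIV (\<lambda>(a, b). (a::'a::real_inner) \<bullet> b)"
  unfolding split_beta' by (intro continuous_intros)

lemma norm_inner_le: "norm (a \<bullet> b) \<le> norm a * norm b"
  by (simp add: Cauchy_Schwarz_ineq2)

context
  fixes s \<delta> b0 :: real and w0 :: "real \<Rightarrow> real" and w :: "real^'n \<Rightarrow> real"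
  assumes \<delta>: "\<delta> > 0" and profile: "cutoff_profile \<delta> b0 w0" and w: "\<And>x. w x = w0 (norm x)"
begin

lemma cutoff_continuous: "continuous_on UNIV w"
proof -
  have "Ck_on 0 w0 {0..}"
    using profile unfolding cutoff_profile_def Cc_inf_def smooth_on_def by blast
  then have "continuous_on UNIV (\<lambda>x. w0 (norm (x::real^'n)))"
    unfolding Ck_on.simps by (rule continuous_on_compose2) (auto intro: continuous_intros)
  then show ?thesis unfolding w[THEN ext] .
qed

lemma cutoff_bounds: "0 \<le> w z" "w z \<le> w0 0"
proof -
  have "\<forall>t\<ge>0. w0 t \<ge> 0" and anti: "antimono_on {0..} w0"
    using profile unfolding cutoff_profile_def by blast+
  then show "0 \<le> w z" unfolding w by simp
  show "w z \<le> w0 0" unfolding w using monotone_onD[OF anti, of 0 "norm z"] by simp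
qed

lemma cutoff_eq_0: "w z = 0" if "norm z \<ge> \<delta>"
proof (rule ccontr)
  assume "w z \<noteq> 0"
  then have "norm z \<in> supp_on w0 {0..}"
    unfolding supp_on_def w by (intro subsetD[OF closure_subset]) simp
  also have "\<dots> \<subseteq> {0..<\<delta>}" using profile unfolding cutoff_profile_def by blast
  finally show False using that by simp
qed

lemma cutoff_even: "w (- z) = w z"
  by (simp add: w)

lemma riesz_kernel_measurable: "riesz_kernel s w \<in> borel_measurable borel"
proof -
  note meas = borel_measurable_continuous_onI[OF cutoff_continuous]
  show ?thesis
    unfolding riesz_kernel_def[abs_def]
    by (rule borel_measurable_scaleR[OF borel_measurable_divide[OF meas powr_real_measurable]]) simp_all
qed

text \<open>One factor \<open>norm z\<close> lowers the order of the singularity from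
  \<open>n + s\<close> to \<open>n + s - 1\<close>. As the profile is nonincreasing,
  \<open>w0 0\<close> bounds the cut-off.\<close>

lemma norm_riesz_kernel_le:
  "norm z * norm (riesz_kernel s w z) \<le>
    w0 0 * (indicator (ball 0 \<delta>) z * norm z powr - (real CARD('n) + s - 1))"
proof (cases "z = 0 \<or> norm z \<ge> \<delta>")
  case True
  then show ?thesis using cutoff_eq_0[of z] by (auto simp: norm_riesz_kernel)
next
  case False
  then have "norm z * norm z powr - (real CARD('n) + s) = norm z powr - (real CARD('n) + s - 1)"
    using powr_add[of "norm z" 1 "- (real CARD('n) + s)"] by (simp add: algebra_simps)
  then have "norm z * norm (riesz_kernel s w z) = w z * norm z powr - (real CARD('n) + s - 1)"
    using cutoff_bounds[of z] by (simp add: norm_riesz_kernel)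
  also have "\<dots> \<le> w0 0 * norm z powr - (real CARD('n) + s - 1)"
    using cutoff_bounds by (intro mult_right_mono) auto
  finally show ?thesis using False by simp
qed

lemma integrable_riesz_majorant:
  assumes "0 \<le> s" "s < 1"
  shows "integrable lborel (\<lambda>z::real^'n. w0 0 * (indicator (ball 0 \<delta>) z * norm z powr - (real CARD('n) + s - 1)))"
proof -
  \<comment> \<open>The exponent \<open>n + s - 1\<close> is nonnegative since the dimension is at
    least 1, and it is below the dimension since \<open>s < 1\<close>.\<close>
  have "1 \<le> real CARD('n)" using zero_less_card_finite[where 'a='n] by linarith
  then have "0 \<le> real CARD('n) + s - 1" using assms by linarith
  then show ?thesis
    using assms \<delta> by (intro integrable_mult_right integrable_indicator_ball_norm_powr) simp_all
qed

text \<open>Away from the removed ball the power is largest at radius \<open>r\<close>. The bound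
  blows up as \<open>r\<close> tends to 0, so it serves only at a fixed truncation level.\<close>

lemma truncate_riesz_kernel_bounded:
  assumes "0 \<le> s" "r > 0"
  shows "norm (truncate r (riesz_kernel s w) z) \<le> w0 0 * r powr - (real CARD('n) + s)"
proof (cases "norm z \<ge> r")
  case True
  then have "norm (riesz_kernel s w z) \<le> w0 0 * r powr - (real CARD('n) + s)"
    using assms cutoff_bounds[of z] unfolding norm_riesz_kernel
    by (intro mult_mono powr_mono2') auto
  then show ?thesis by (rule order_trans[OF norm_truncate_le])
next
  case False
  then show ?thesis using cutoff_bounds[of 0] by (simp add: truncate_def)
qed

lemma truncate_riesz_kernel_odd:
  "truncate r (riesz_kernel s w) (- z) = - truncate r (riesz_kernel s w) z"
  by (simp add: truncate_def riesz_kernel_def cutoff_even indicator_def)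

lemma truncate_riesz_kernel_eq_0:
  "norm z \<ge> \<delta> \<Longrightarrow> truncate r (riesz_kernel s w) z = 0"
  by (simp add: truncate_def riesz_kernel_def cutoff_eq_0)

text \<open>The cut-off already vanishes outside the ball, so the inner integral may be taken over
  the whole space.\<close>

lemma nl_grad_eq:
  "nl_grad s \<delta> w u x = c_const CARD('n) s *\<^sub>R (\<integral>y. (u x - u y) *\<^sub>R riesz_kernel s w (x - y) \<partial>lborel)"
proof -
  have "indicator (ball x \<delta>) y *\<^sub>R (((u x - u y) * w (x - y) / norm (x - y) powr (real CARD('n) + s + 1)) *\<^sub>R (x - y))
      = (u x - u y) *\<^sub>R riesz_kernel s w (x - y)" for y
    using cutoff_eq_0[of "x - y"]
    by (cases "norm (x - y) < \<delta>") (auto simp: indicator_def riesz_kernel_def dist_norm)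
  then show ?thesis by (simp add: nl_grad_def set_lebesgue_integral_def)
qed

text \<open>Removing a small ball amounts to truncating the kernel. Oddness then replaces the sum of
  the values of \<phi> by minus their difference, for which the principal value is an absolutely
  convergent integral.\<close>

lemma nl_div_eq:
  assumes s: "0 \<le> s" "s < 1" and \<phi>[measurable]: "\<phi> \<in> borel_measurable borel"
    and P: "\<And>x. norm (\<phi> x) \<le> P" and L: "\<And>x y. norm (\<phi> x - \<phi> y) \<le> L * norm (x - y)"
  shows "nl_div s \<delta> w \<phi> x = c_const CARD('n) s * (\<integral>y. (\<phi> x - \<phi> y) \<bullet> riesz_kernel s w (x - y) \<partial>lborel)"
proof -
  let ?K = "riesz_kernel s w"
  let ?T = "\<lambda>r. LINT y:ball x \<delta> - ball x r|lborel.
        ((\<phi> x + \<phi> y) \<bullet> (x - y)) / norm (x - y) powr (real CARD('n) + s + 1) * w (x - y)"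
  have T: "?T r = - (\<integral>y. (\<phi> x - \<phi> y) \<bullet> truncate r ?K (x - y) \<partial>lborel)" if "r > 0" for r
  proof -
    have "indicator (ball x \<delta> - ball x r) y *\<^sub>R
        (((\<phi> x + \<phi> y) \<bullet> (x - y)) / norm (x - y) powr (real CARD('n) + s + 1) * w (x - y)) =
        (\<phi> x + \<phi> y) \<bullet> truncate r ?K (x - y)" for y
      using cutoff_eq_0[of "x - y"]
      by (auto simp: indicator_def riesz_kernel_def truncate_def dist_norm norm_minus_commute[of y x])
    then have "?T r = (\<integral>y. (\<phi> x + \<phi> y) \<bullet> truncate r ?K (x - y) \<partial>lborel)"
      by (simp add: set_lebesgue_integral_def)
    \<comment> \<open>With \<open>c = 1\<close> and \<open>c = -1\<close> the sum and the difference
      integrate to opposite values, namely plus and minus the integral of the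
      \<open>\<phi> y\<close> term.\<close>
    then show ?thesis
      using integral_plus_odd_kernel[OF \<phi> truncate_measurable[OF riesz_kernel_measurable] P
        truncate_riesz_kernel_bounded[OF s(1) that] truncate_riesz_kernel_eq_0 truncate_riesz_kernel_odd,
        where c = "-1" and x = x]
        integral_plus_odd_kernel[OF \<phi> truncate_measurable[OF riesz_kernel_measurable] P
        truncate_riesz_kernel_bounded[OF s(1) that] truncate_riesz_kernel_eq_0 truncate_riesz_kernel_odd,
        where c = "1" and x = x]
      by simp
  qed
  have "((\<lambda>r. - (\<integral>y. (\<phi> x - \<phi> y) \<bullet> truncate r ?K (x - y) \<partial>lborel)) \<longlongrightarrow>
      - (\<integral>y. (\<phi> x - \<phi> y) \<bullet> ?K (x - y) \<partial>lborel)) (at_right 0)"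
    by (rule tendsto_minus[OF integral_diff_truncate_tendsto[OF continuous_on_inner_pair norm_inner_le
          \<phi> riesz_kernel_measurable L norm_riesz_kernel_le integrable_riesz_majorant[OF s]]])
  then have "(?T \<longlongrightarrow> - (\<integral>y. (\<phi> x - \<phi> y) \<bullet> ?K (x - y) \<partial>lborel)) (at_right 0)"
    by (rule Lim_transform_eventually) (rule eventually_mono[OF eventually_at_right_less], rule T[symmetric])
  then have "Lim (at_right 0) ?T = - (\<integral>y. (\<phi> x - \<phi> y) \<bullet> ?K (x - y) \<partial>lborel)"
    by (rule tendsto_Lim[rotated]) simp
  then show ?thesis by (simp add: nl_div_def)
qed

end

section \<open>Limits of the truncated integrals and the integration by parts formula\<close>

lemma continuous_on_scaleR_pair: "continuous_on UNIV (\<lambda>(a, b). a *\<^sub>R (b::'a::real_normed_vector))"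
  unfolding split_beta' by (intro continuous_intros)

lemma norm_scaleR_le: "norm (a *\<^sub>R b) \<le> norm a * norm b"
  by simp

lemma bounded_set_integral_tendsto_at_right:
  fixes s :: "real \<Rightarrow> 'a::euclidean_space \<Rightarrow> real"
  assumes A: "A \<in> sets borel" "bounded A"
    and f: "f \<in> borel_measurable borel" and s: "\<And>r. s r \<in> borel_measurable borel"
    and bound: "\<And>r x. norm (s r x) \<le> B"
    and lim: "\<And>x. ((\<lambda>r. s r x) \<longlongrightarrow> f x) (at_right 0)"
  shows "((\<lambda>r. LINT x:A|lborel. s r x) \<longlongrightarrow> (LINT x:A|lborel. f x)) (at_right 0)"
  unfolding set_lebesgue_integral_def
proof (rule integral_dominated_convergence_at_right[where g = "\<lambda>x. indicator A x *\<^sub>R B"])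
  have A': "A \<in> sets lborel" using A(1) by (simp only: sets_lborel)
  have M: "(\<lambda>x. indicator A x *\<^sub>R g x) \<in> borel_measurable lborel"
    if "g \<in> borel_measurable borel" for g :: "'a \<Rightarrow> real"
    by (intro borel_measurable_scaleR borel_measurable_indicator[OF A'])
      (simp only: that measurable_lborel2)
  show "(\<lambda>x. indicator A x *\<^sub>R f x) \<in> borel_measurable lborel" by (rule M[OF f])
  show "(\<lambda>x. indicator A x *\<^sub>R s r x) \<in> borel_measurable lborel" for r by (rule M[OF s])
  show "integrable lborel (\<lambda>x. indicator A x *\<^sub>R B)"
    by (rule integrable_scaleR_left) (use A' emeasure_bounded_finite[OF A(2)] in simp)
  show "((\<lambda>r. indicator A x *\<^sub>R s r x) \<longlongrightarrow> indicator A x *\<^sub>R f x) (at_right 0)" for x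
    by (intro tendsto_scaleR tendsto_const lim)
  show "norm (indicator A x *\<^sub>R s r x) \<le> indicator A x *\<^sub>R B" for r x
    using bound[of r x] by (simp add: indicator_def)
qed

text \<open>By Fubini both sides are integrals over the product space, where the norm of
  \<open>f\<close> is a majorant. Off the diagonal the indicator is eventually 1; the diagonal is
  cut out for every \<open>r > 0\<close>, and there \<open>f\<close> is 0.\<close>

lemma truncated_double_integral_tendsto:
  fixes f :: "'a::euclidean_space \<times> 'a \<Rightarrow> real"
  assumes f: "integrable (lborel \<Otimes>\<^sub>M lborel) f" and diag: "\<And>x. f (x, x) = 0"
  shows "((\<lambda>r. \<integral>x. \<integral>y. indicator (- ball x r) y * f (x, y) \<partial>lborel \<partial>lborel) \<longlongrightarrow>
    (\<integral>x. \<integral>y. f (x, y) \<partial>lborel \<partial>lborel)) (at_right 0)"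
proof -
  define S where "S r = {z::'a \<times> 'a. r \<le> dist (fst z) (snd z)}" for r
  have "closed (S r)" for r
    unfolding S_def by (intro closed_Collect_le continuous_intros)
  then have S: "S r \<in> sets (lborel \<Otimes>\<^sub>M lborel)" for r
    unfolding lborel_prod sets_lborel by (rule borel_closed)
  have eq: "indicator (- ball x r) y * f (x, y) = indicator (S r) (x, y) * f (x, y)" for x y r
    by (simp add: indicator_def S_def)
  have int: "integrable (lborel \<Otimes>\<^sub>M lborel) (\<lambda>z. indicator (S r) z * f z)" for r
    using integrable_mult_indicator[OF S f, of r] by (simp only: real_scaleR_def)
  have "((\<lambda>r. \<integral>z. indicator (S r) z * f z \<partial>(lborel \<Otimes>\<^sub>M lborel)) \<longlongrightarrow>
      integral\<^sup>L (lborel \<Otimes>\<^sub>M lborel) f) (at_right 0)"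
  proof (rule integral_dominated_convergence_at_right[where g = "\<lambda>z. norm (f z)"])
    show "integrable (lborel \<Otimes>\<^sub>M lborel) (\<lambda>z. norm (f z))" by (rule integrable_norm[OF f])
    show "norm (indicator (S r) z * f z) \<le> norm (f z)" for r z by (simp add: indicator_def)
    show "((\<lambda>r. indicator (S r) z * f z) \<longlongrightarrow> f z) (at_right 0)" for z
    proof (cases "fst z = snd z")
      case True
      then have "f z = 0" using diag[of "fst z"] by (metis prod.collapse)
      then show ?thesis by simp
    next
      case False
      show ?thesis
        by (rule tendsto_eventually, unfold eventually_at_right_field, intro exI[of _ "dist (fst z) (snd z)"])
          (use False in \<open>auto simp: S_def\<close>)
    qed
  qed (rule borel_measurable_integrable[OF f] borel_measurable_integrable[OF int])+
  then show ?thesis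
    unfolding eq lborel_pair.integral_fst'[OF int, symmetric] lborel_pair.integral_fst'[OF f, symmetric] .
qed

theorem theorem3p9:
  fixes \<Omega> :: "(real^'n) set" and s \<delta> b0 :: real and w0 :: "real \<Rightarrow> real"
    and w u :: "real^'n \<Rightarrow> real" and \<phi> :: "real^'n \<Rightarrow> real^'n"
  assumes "open \<Omega>" and "bounded \<Omega>"
    and "0 \<le> s" and "s < 1" and "\<delta> > 0"
    and "cutoff_profile \<delta> b0 w0" and "\<And>x. w x = w0 (norm x)"
    and "u \<in> Cc_inf UNIV" and "\<phi> \<in> Cc_inf UNIV"
  shows "(set_integrable (lborel \<Otimes>\<^sub>M lborel) (collar \<Omega> \<delta> \<times> \<Omega>)
             (\<lambda>(x, y). collar_integrand s w u \<phi> x y) \<longrightarrow>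
           (LINT x:\<Omega>|lborel. nl_grad s \<delta> w u x \<bullet> \<phi> x) =
             - (LINT y:\<Omega>|lborel. u y * nl_div s \<delta> w \<phi> y)
             - c_const CARD('n) s *
               (LINT x:collar \<Omega> \<delta>|lborel. LINT y:\<Omega>|lborel. collar_integrand s w u \<phi> x y)) \<and>
         ((\<lambda>r. - (LINT y:\<Omega>|lborel. u y * nl_div s \<delta> w \<phi> y)
               - c_const CARD('n) s *
                 (LINT x:collar \<Omega> \<delta>|lborel. LINT y:\<Omega> - ball x r|lborel.
                    collar_integrand s w u \<phi> x y))
           \<longlongrightarrow> (LINT x:\<Omega>|lborel. nl_grad s \<delta> w u x \<bullet> \<phi> x)) (at_right 0)"
proof -
  note s = assms(3,4) and cutoff = assms(5-7)
  obtain U Lu where "continuous_on UNIV u" and U: "\<And>x. norm (u x) \<le> U"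
    and Lu: "\<And>x y. norm (u x - u y) \<le> Lu * norm (x - y)"
    using Cc_inf_bounded_lipschitz[OF assms(8)] by blast
  then have u: "u \<in> borel_measurable borel" by (intro borel_measurable_continuous_onI)
  obtain P L where "continuous_on UNIV \<phi>" and P: "\<And>x. norm (\<phi> x) \<le> P"
    and L: "\<And>x y. norm (\<phi> x - \<phi> y) \<le> L * norm (x - y)"
    using Cc_inf_bounded_lipschitz[OF assms(9)] by blast
  then have \<phi>: "\<phi> \<in> borel_measurable borel" by (intro borel_measurable_continuous_onI)
  have \<Omega>: "\<Omega> \<in> sets borel" using assms(1) by (rule borel_open)
  define c where "c = c_const CARD('n) s"
  define K where "K = riesz_kernel s w"
  note K_meas = riesz_kernel_measurable[OF cutoff, of s, folded K_def]
  note K_le = norm_riesz_kernel_le[OF cutoff, of _ s, folded K_def]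
  note majorant = integrable_riesz_majorant[OF cutoff s]
  note truncate_K = truncate_riesz_kernel_bounded[OF cutoff s(1), folded K_def]
    truncate_riesz_kernel_odd[OF cutoff, of _ s, folded K_def]
    truncate_riesz_kernel_eq_0[OF cutoff, of _ _ s, folded K_def]
  \<comment> \<open>Up to the constant \<open>c\<close>, \<open>A 0\<close> is the gradient and
    \<open>E 0\<close> the divergence. For \<open>r > 0\<close> they are the versions with a bounded
    kernel.\<close>
  define A where "A r x = (\<integral>y. (u x - u y) *\<^sub>R truncate r K (x - y) \<partial>lborel)" for r x
  define E where "E r x = (\<integral>y. (\<phi> x - \<phi> y) \<bullet> truncate r K (x - y) \<partial>lborel)" for r x
  note A_facts = continuous_on_scaleR_pair norm_scaleR_le u K_meas Lu K_le majorant
  note E_facts = continuous_on_inner_pair norm_inner_le \<phi> K_meas L K_le majorant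
  have A_lim: "((\<lambda>r. A r x) \<longlongrightarrow> A 0 x) (at_right 0)" for x
    using integral_diff_truncate_tendsto[OF A_facts] unfolding A_def truncate_nonpos[OF order_refl] .
  have E_lim: "((\<lambda>r. E r x) \<longlongrightarrow> E 0 x) (at_right 0)" for x
    using integral_diff_truncate_tendsto[OF E_facts] unfolding E_def truncate_nonpos[OF order_refl] .
  \<comment> \<open>These bounds are uniform in both \<open>r\<close> and \<open>x\<close>, so on
    the bounded set \<Omega> a constant serves as majorant.\<close>
  obtain a where a: "\<And>r x. norm (A r x) \<le> a"
    using norm_integral_diff_truncate_le[OF A_facts] unfolding A_def by blast
  obtain e where e: "\<And>r x. norm (E r x) \<le> e"
    using norm_integral_diff_truncate_le[OF E_facts] unfolding E_def by blast
  have A_meas: "A r \<in> borel_measurable borel" for r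
    unfolding A_def[abs_def] by (rule integral_diff_truncate_measurable[OF A_facts])
  have E_meas: "E r \<in> borel_measurable borel" for r
    unfolding E_def[abs_def] by (rule integral_diff_truncate_measurable[OF E_facts])

  have A_int: "((\<lambda>r. LINT x:\<Omega>|lborel. A r x \<bullet> \<phi> x) \<longlongrightarrow> (LINT x:\<Omega>|lborel. A 0 x \<bullet> \<phi> x)) (at_right 0)"
  proof (rule bounded_set_integral_tendsto_at_right[OF \<Omega> assms(2), where B = "a * P"])
    show "norm (A r x \<bullet> \<phi> x) \<le> a * P" for r x
      by (rule order_trans[OF norm_inner_le mult_mono[OF a P order_trans[OF norm_ge_zero a] norm_ge_zero]])
  qed (intro borel_measurable_inner A_meas \<phi> tendsto_inner A_lim tendsto_const)+
  have E_int: "((\<lambda>r. LINT x:\<Omega>|lborel. u x * E r x) \<longlongrightarrow> (LINT x:\<Omega>|lborel. u x * E 0 x)) (at_right 0)"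
  proof (rule bounded_set_integral_tendsto_at_right[OF \<Omega> assms(2), where B = "U * e"])
    show "norm (u x * E r x) \<le> U * e" for r x
      unfolding norm_mult by (rule mult_mono[OF U e order_trans[OF norm_ge_zero U] norm_ge_zero])
  qed (intro borel_measurable_times E_meas u tendsto_mult E_lim tendsto_const)+

  define Coll where "Coll r = (LINT x:collar \<Omega> \<delta>|lborel. LINT y:\<Omega> - ball x r|lborel.
      collar_integrand s w u \<phi> x y)" for r
  have integrand: "collar_integrand s w u \<phi> x y = (u y *\<^sub>R \<phi> x + u x *\<^sub>R \<phi> y) \<bullet> K (y - x)" for x y
    unfolding K_def by (rule collar_integrand_eq) (simp only: assms(7) norm_minus_commute)
  \<comment> \<open>The bounded-kernel formula solved for the collar term. Removing
    \<open>ball x r\<close> from the inner domain is again a truncation of the kernel.\<close>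
  have Coll: "Coll r = - (LINT x:\<Omega>|lborel. u x * E r x) - (LINT x:\<Omega>|lborel. A r x \<bullet> \<phi> x)"
    if "r > 0" for r
  proof -
    have "indicator (\<Omega> - ball x r) y *\<^sub>R collar_integrand s w u \<phi> x y =
        indicator \<Omega> y *\<^sub>R ((u y *\<^sub>R \<phi> x + u x *\<^sub>R \<phi> y) \<bullet> truncate r K (y - x))" for x y
      by (simp add: integrand truncate_def indicator_def dist_norm norm_minus_commute[of x y])
    then have "Coll r = (LINT x:collar \<Omega> \<delta>|lborel. LINT y:\<Omega>|lborel.
        (u y *\<^sub>R \<phi> x + u x *\<^sub>R \<phi> y) \<bullet> truncate r K (y - x))"
      unfolding Coll_def set_lebesgue_integral_def by (simp only:)
    moreover have "(LINT x:\<Omega>|lborel. A r x \<bullet> \<phi> x) = - (LINT x:\<Omega>|lborel. u x * E r x)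
        - (LINT x:collar \<Omega> \<delta>|lborel. LINT y:\<Omega>|lborel.
            (u y *\<^sub>R \<phi> x + u x *\<^sub>R \<phi> y) \<bullet> truncate r K (y - x))"
      unfolding A_def E_def
      by (rule bounded_kernel_integration_by_parts[OF \<Omega> assms(2) u \<phi> truncate_measurable[OF K_meas]
            U P truncate_K(1)[OF that] truncate_K(2)])
        (rule truncate_K(3))
    ultimately show ?thesis by linarith
  qed
  have grad: "(LINT x:\<Omega>|lborel. nl_grad s \<delta> w u x \<bullet> \<phi> x) = c * (LINT x:\<Omega>|lborel. A 0 x \<bullet> \<phi> x)"
    unfolding nl_grad_eq[OF cutoff] A_def truncate_nonpos[OF order_refl] K_def c_def
      inner_scaleR_left set_integral_mult_right ..
  have "u x * nl_div s \<delta> w \<phi> x = c * (u x * E 0 x)" for x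
    unfolding nl_div_eq[OF cutoff s \<phi> P L] E_def truncate_nonpos[OF order_refl] K_def c_def
    by (rule mult.left_commute)
  then have div: "(LINT x:\<Omega>|lborel. u x * nl_div s \<delta> w \<phi> x) = c * (LINT x:\<Omega>|lborel. u x * E 0 x)"
    by (simp only: set_integral_mult_right)
  let ?I = "\<lambda>r. - (LINT y:\<Omega>|lborel. u y * nl_div s \<delta> w \<phi> y) - c * Coll r"
  \<comment> \<open>Only the collar term depends on \<open>r\<close>; the divergence term already
    has its limiting value. In the limit the two integrals of \<open>u x * E 0 x\<close>
    cancel.\<close>
  have "((\<lambda>r. - (c * (LINT x:\<Omega>|lborel. u x * E 0 x)) -
        c * (- (LINT x:\<Omega>|lborel. u x * E r x) - (LINT x:\<Omega>|lborel. A r x \<bullet> \<phi> x))) \<longlongrightarrow>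
      - (c * (LINT x:\<Omega>|lborel. u x * E 0 x)) -
        c * (- (LINT x:\<Omega>|lborel. u x * E 0 x) - (LINT x:\<Omega>|lborel. A 0 x \<bullet> \<phi> x))) (at_right 0)"
    by (intro tendsto_diff tendsto_const tendsto_mult tendsto_minus E_int A_int)
  moreover have "- (c * p) - c * (- p - q) = c * q" for p q :: real
    by (simp add: algebra_simps)
  ultimately have "((\<lambda>r. - (c * (LINT x:\<Omega>|lborel. u x * E 0 x)) -
        c * (- (LINT x:\<Omega>|lborel. u x * E r x) - (LINT x:\<Omega>|lborel. A r x \<bullet> \<phi> x))) \<longlongrightarrow>
      (LINT x:\<Omega>|lborel. nl_grad s \<delta> w u x \<bullet> \<phi> x)) (at_right 0)"
    unfolding grad by (simp only:)
  then have lim: "(?I \<longlongrightarrow> (LINT x:\<Omega>|lborel. nl_grad s \<delta> w u x \<bullet> \<phi> x)) (at_right 0)"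
    by (rule Lim_transform_eventually)
      (rule eventually_mono[OF eventually_at_right_less], simp only: div Coll)
  \<comment> \<open>Under absolute integrability \<open>Coll\<close> also tends to the full double
    integral, so uniqueness of limits turns the convergence into an identity.\<close>
  have "(LINT x:\<Omega>|lborel. nl_grad s \<delta> w u x \<bullet> \<phi> x) = - (LINT y:\<Omega>|lborel. u y * nl_div s \<delta> w \<phi> y)
      - c * (LINT x:collar \<Omega> \<delta>|lborel. LINT y:\<Omega>|lborel. collar_integrand s w u \<phi> x y)"
    if "set_integrable (lborel \<Otimes>\<^sub>M lborel) (collar \<Omega> \<delta> \<times> \<Omega>) (\<lambda>(x, y). collar_integrand s w u \<phi> x y)"
  proof -
    \<comment> \<open>The collar is disjoint from \<Omega>, so \<open>?f\<close> vanishes on the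
      diagonal.\<close>
    let ?f = "\<lambda>z. indicator (collar \<Omega> \<delta> \<times> \<Omega>) z *\<^sub>R (\<lambda>(x, y). collar_integrand s w u \<phi> x y) z"
    have "((\<lambda>r. \<integral>x. \<integral>y. indicator (- ball x r) y * ?f (x, y) \<partial>lborel \<partial>lborel) \<longlongrightarrow>
        (\<integral>x. \<integral>y. ?f (x, y) \<partial>lborel \<partial>lborel)) (at_right 0)"
      by (rule truncated_double_integral_tendsto[OF that[unfolded set_integrable_def]])
        (simp add: collar_def indicator_def)
    moreover have "(\<integral>x. \<integral>y. indicator (- ball x r) y * ?f (x, y) \<partial>lborel \<partial>lborel) = Coll r" for r
    proof -
      have "indicator (- ball x r) y * ?f (x, y) =
          indicator (collar \<Omega> \<delta>) x *\<^sub>R (indicator (\<Omega> - ball x r) y *\<^sub>R collar_integrand s w u \<phi> x y)" for x y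
        by (auto simp: indicator_def)
      then show ?thesis unfolding Coll_def set_lebesgue_integral_def
        by (simp only: integral_scaleR_right)
    qed
    moreover have "(\<integral>x. \<integral>y. ?f (x, y) \<partial>lborel \<partial>lborel) =
        (LINT x:collar \<Omega> \<delta>|lborel. LINT y:\<Omega>|lborel. collar_integrand s w u \<phi> x y)"
    proof -
      have "?f (x, y) = indicator (collar \<Omega> \<delta>) x *\<^sub>R (indicator \<Omega> y *\<^sub>R collar_integrand s w u \<phi> x y)" for x y
        by (simp add: indicator_def)
      then show ?thesis unfolding set_lebesgue_integral_def
        by (simp only: integral_scaleR_right)
    qed
    ultimately have "(Coll \<longlongrightarrow> (LINT x:collar \<Omega> \<delta>|lborel. LINT y:\<Omega>|lborel. collar_integrand s w u \<phi> x y)) (at_right 0)"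
      by (simp only:)
    then have "(?I \<longlongrightarrow> - (LINT y:\<Omega>|lborel. u y * nl_div s \<delta> w \<phi> y)
        - c * (LINT x:collar \<Omega> \<delta>|lborel. LINT y:\<Omega>|lborel. collar_integrand s w u \<phi> x y)) (at_right 0)"
      by (intro tendsto_diff tendsto_const tendsto_mult)
    then show ?thesis by (rule tendsto_unique[OF trivial_limit_at_right_real lim])
  qed
  with lim show ?thesis unfolding c_def Coll_def by blast
qed

end
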